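(* For each $x\in(\frac{\sqrt3}{2},\infty)$ there exists a representation $\rho_x:G(3_1)\to\mathcal L(E^{1,2})$, unique up to conjugation in $\mathcal L(E^{1,2})$, of the form $$\rho_x(a)=(sA^-,A),\qquad\rho_x(b)=(sB^-+(A^-B^-)^-,B)$$ (with $s\in\mathbb R$), where $A,B\in SL(2,\mathbb R)$ are: 1. for $\frac{\sqrt3}{2}<x<1$: $A=x+\sqrt{1-x^2}\,i$, $\;B=x+\frac{2x^2-1}{2\sqrt{1-x^2}}\,i+\frac12\sqrt{\frac{4x^2-3}{1-x^2}}\,j$; 2. for $x=1$: $A=1+i+j$, $\;B=1+\frac14(i-j)$; 3. for $x>1$: $A=x+\sqrt{x^2-1}\,j$, $\;B=x-\frac12\sqrt{\frac{4x^2-3}{x^2-1}}\,i-\frac{2x^2-1}{2\sqrt{x^2-1}}\,j$. In affine linear notation, where $(X,Y,Z)$ are the coordinates with respect to the basis $\{-ij,j,i\}$ of $H_0$ and a transformation acts on the column vector $(X,Y,Z,1)^T$, $\rho_x(a)$ and $\rho_x(b)$ are given by the following matrices $M_x(a)$, $M_x(b)$. 1. For $\frac{\sqrt3}{2}<x<1$: $$M_x(a)=\begin{pmatrix}2x^2-1&-2x\sqrt{1-x^2}&0&0\\2x\sqrt{1-x^2}&2x^2-1&0&0\\0&0&1&\frac{(3-4x^2)\sqrt{1-x^2}}{4x}\\0&0&0&1\end{pmatrix},$$ $$M_x(b)=\begin{pmatrix}2x^2-1&\frac{x-2x^3}{\sqrt{1-x^2}}&x\sqrt{\frac{3-4x^2}{x^2-1}}&-\frac12\sqrt{4x^2-3}\\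 \frac{x(2x^2-1)}{\sqrt{1-x^2}}&\frac{1+2x^2-4x^4}{2-2x^2}&\frac{\sqrt{4x^2-3}(2x^2-1)}{2(1-x^2)}&-\frac{\sqrt{(4x^2-3)^3}}{8x\sqrt{1-x^2}}\\ x\sqrt{\frac{3-4x^2}{x^2-1}}&-\frac{\sqrt{4x^2-3}(2x^2-1)}{2(1-x^2)}&\frac{1-2x^2}{2x^2-2}&\frac{-3+10x^2-8x^4}{8x\sqrt{1-x^2}}\\0&0&0&1\end{pmatrix}.$$ 2. For $x=1$: $$M_1(a)=\begin{pmatrix}1&-2&2&0\\2&-1&2&-\frac14\\2&-2&3&-\frac14\\0&0&0&1\end{pmatrix},\qquad M_1(b)=\begin{pmatrix}1&-\frac12&-\frac12&\frac12\\ \frac12&\frac78&-\frac18&\frac1{16}\\-\frac12&\frac18&\frac98&-\frac1{16}\\0&0&0&1\end{pmatrix}.$$ 3. For $x>1$: $$M_x(a)=\begin{pmatrix}2x^2-1&0&2x\sqrt{x^2-1}&0\\0&1&0&\frac{(3-4x^2)\sqrt{x^2-1}}{4x}\\2x\sqrt{x^2-1}&0&2x^2-1&0\\0&0&0&1\end{pmatrix},$$ $$M_x(b)=\begin{pmatrix}2x^2-1&x\sqrt{\frac{4x^2-3}{x^2-1}}&-\frac{x(2x^2-1)}{\sqrt{x^2-1}}&-\frac12\sqrt{4x^2-3}\\-x\sqrt{\frac{4x^2-3}{x^2-1}}&\frac{1-2x^2}{2x^2-2}&\frac{\sqrt{4x^2-3}(2x^2-1)}{2(x^2-1)}&\frac{3-10x^2+8x^4}{8x\sqrt{x^2-1}}\\-\frac{x(2x^2-1)}{\sqrt{x^2-1}}&-\frac{\sqrt{4x^2-3}(2x^2-1)}{2(x^2-1)}&\frac{1+2x^2-4x^4}{2-2x^2}&\frac{\sqrt{(4x^2-3)^3}}{8x\sqrt{x^2-1}}\\0&0&0&1\end{pmatrix}.$$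 The distance $\delta$ and the angle $\omega$ between the axes of $\rho_x(a)$ and $\rho_x(b)$ are given by $\delta=\frac{\sqrt{3-4x^2}}{4}$ and $\cos\omega=\frac{2x^2-1}{2-2x^2}$, and the shift is $\sigma=\left(\frac{3}{4x}-x\right)\sqrt{1-x^2}$.
   Context: $G(3_1)=\langle a,b\mid aba=bab\rangle$ is the trefoil knot group. $H=\left(\frac{-1,1}{\mathbb R}\right)\cong M(2,\mathbb R)$ is the quaternion algebra with basis $1,i,j,ij$, where $i^2=-1$, $j^2=1$, $ij=-ji$. For a quaternion $A$ write $A=A^++A^-$ with $A^+$ the scalar part and $A^-$ the pure part, $\overline A=A^+-A^-$, $N(A)=A\overline A$. The norm-one group is $U_1=SL(2,\mathbb R)$, and $H_0\cong E^{1,2}$ is the space of pure quaternions with quadratic form $N$ (Minkowski space). $\mathcal L(E^{1,2})$ is the group of affine isometries of $E^{1,2}$ given by $H_0\rtimes SL(2,\mathbb R)$, where $(v,A)$ acts by $u\mapsto v+Au\overline A$. The quantities $\delta,\omega,\sigma$ (which here may be imaginary or complex) are defined formally. With $u=1-x^2=N(A^-)=N(B^-)$ and $y=-(A^-B^-)^+$, one sets $\delta=\frac12\sqrt{u^2-y^2}$ (so that $\delta=\frac12\sqrt{N((A^-B^-)^-)}$), $\cos\omega=\frac{y}{u}$ and $\sigma=s\sqrt u$; square roots of negative reals are taken as $\sqrt{-1}$ times the positive root. The formula for $\cos\omega$ is for $x\neq1$. *)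

theory Defs
  imports "HOL-Analysis.Analysis" "HOL-Algebra.Group"
begin

text \<open>
  \<open>Quat p q r s\<close> stands for \<open>p + q i + r j + s ij\<close>, where
  \<open>i\<^sup>2 = -1\<close>, \<open>j\<^sup>2 = 1\<close> and \<open>ij = -ji\<close>.
\<close>

datatype quat = Quat (scal: real) (coeff_i: real) (coeff_j: real) (coeff_ij: real)

lemma quat_eq_iff:
  "A = B \<longleftrightarrow> scal A = scal B \<and> coeff_i A = coeff_i B \<and> coeff_j A = coeff_j B
     \<and> coeff_ij A = coeff_ij B"
  by (cases A; cases B) auto

instantiation quat :: real_algebra_1
begin

definition zero_quat :: quat where
  "0 = Quat 0 0 0 0"

definition one_quat :: quat where
  "1 = Quat 1 0 0 0"

definition plus_quat :: "quat \<Rightarrow> quat \<Rightarrow> quat" where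
  "A + B = Quat (scal A + scal B) (coeff_i A + coeff_i B) (coeff_j A + coeff_j B)
     (coeff_ij A + coeff_ij B)"

definition uminus_quat :: "quat \<Rightarrow> quat" where
  "- A = Quat (- scal A) (- coeff_i A) (- coeff_j A) (- coeff_ij A)"

definition minus_quat :: "quat \<Rightarrow> quat \<Rightarrow> quat" where
  "A - B = Quat (scal A - scal B) (coeff_i A - coeff_i B) (coeff_j A - coeff_j B)
     (coeff_ij A - coeff_ij B)"

definition scaleR_quat :: "real \<Rightarrow> quat \<Rightarrow> quat" where
  "c *\<^sub>R A = Quat (c * scal A) (c * coeff_i A) (c * coeff_j A) (c * coeff_ij A)"

definition times_quat :: "quat \<Rightarrow> quat \<Rightarrow> quat" where
  "A * B = Quat
     (scal A * scal B - coeff_i A * coeff_i B + coeff_j A * coeff_j B + coeff_ij A * coeff_ij B)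
     (scal A * coeff_i B + coeff_i A * scal B - coeff_j A * coeff_ij B + coeff_ij A * coeff_j B)
     (scal A * coeff_j B + coeff_j A * scal B - coeff_i A * coeff_ij B + coeff_ij A * coeff_i B)
     (scal A * coeff_ij B + coeff_ij A * scal B + coeff_i A * coeff_j B - coeff_j A * coeff_i B)"

lemmas quat_ops = zero_quat_def one_quat_def plus_quat_def uminus_quat_def minus_quat_def
  scaleR_quat_def times_quat_def

instance
  by standard (simp_all add: quat_ops quat_eq_iff algebra_simps)

end

definition quat_i :: quat where
  "quat_i = Quat 0 1 0 0"

definition quat_j :: quat where
  "quat_j = Quat 0 0 1 0"

lemma quat_basis:
  "quat_i * quat_i = -1" "quat_j * quat_j = 1" "quat_i * quat_j = - (quat_j * quat_i)"
  "Quat p q r s = p *\<^sub>R 1 + q *\<^sub>R quat_i + r *\<^sub>R quat_j + s *\<^sub>R (quat_i * quat_j)"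
  by (simp_all add: quat_i_def quat_j_def quat_ops)

definition pure_part :: "quat \<Rightarrow> quat" where
  "pure_part A = Quat 0 (coeff_i A) (coeff_j A) (coeff_ij A)"

definition qconj :: "quat \<Rightarrow> quat" where
  "qconj A = scal A *\<^sub>R 1 - pure_part A"

text \<open>The product \<open>A * qconj A\<close> is a scalar, see \<open>qnorm_eq\<close>.\<close>

definition qnorm :: "quat \<Rightarrow> real" where
  "qnorm A = scal (A * qconj A)"

lemmas quat_defs = pure_part_def qconj_def qnorm_def quat_ops

lemma qnorm_eq: "A * qconj A = of_real (qnorm A)"
  by (simp add: of_real_def quat_defs algebra_simps)

lemma qconj_mult_self: "qconj A * A = of_real (qnorm A)"
  by (simp add: of_real_def quat_defs algebra_simps)

lemma qnorm_coeffs: "qnorm A = (scal A)\<^sup>2 + (coeff_i A)\<^sup>2 - (coeff_j A)\<^sup>2 - (coeff_ij A)\<^sup>2"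
  by (simp add: quat_defs power2_eq_square)

lemma qconj_mult: "qconj (A * B) = qconj B * qconj A"
  by (simp add: quat_defs algebra_simps)

lemma qconj_qconj [simp]: "qconj (qconj A) = A"
  by (simp add: quat_defs quat_eq_iff)

lemma qnorm_qconj [simp]: "qnorm (qconj A) = qnorm A"
  by (simp add: qnorm_coeffs quat_defs)

lemma qnorm_mult: "qnorm (A * B) = qnorm A * qnorm B"
  by (simp add: quat_defs algebra_simps)

lemma qnorm_one [simp]: "qnorm 1 = 1"
  by (simp add: quat_defs)

definition pure_quats :: "quat set" where
  "pure_quats = {u. scal u = 0}"

definition SL2 :: "quat set" where
  "SL2 = {A. qnorm A = 1}"

text \<open>
  The algebra is isomorphic to the algebra of real \<open>2 \<times> 2\<close> matrices, with the norm
  corresponding to the determinant; this identifies \<open>SL2\<close> with \<open>SL(2, \<real>)\<close>.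
\<close>

definition quat_matrix :: "quat \<Rightarrow> real^2^2" where
  "quat_matrix A = vector [vector [scal A + coeff_j A, coeff_i A - coeff_ij A],
                           vector [- coeff_i A - coeff_ij A, scal A - coeff_j A]]"

lemma quat_matrix_add: "quat_matrix (A + B) = quat_matrix A + quat_matrix B"
  by (simp add: quat_matrix_def quat_defs vec_eq_iff forall_2)

lemma quat_matrix_scaleR: "quat_matrix (c *\<^sub>R A) = c *\<^sub>R quat_matrix A"
  by (simp add: quat_matrix_def quat_defs vec_eq_iff forall_2 algebra_simps)

lemma quat_matrix_one: "quat_matrix 1 = mat 1"
  by (simp add: quat_matrix_def quat_defs vec_eq_iff forall_2 mat_def)

lemma quat_matrix_mult: "quat_matrix (A * B) = quat_matrix A ** quat_matrix B"
  by (simp add: quat_matrix_def quat_defs vec_eq_iff forall_2 matrix_matrix_mult_def sum_2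
      algebra_simps)

lemma bij_quat_matrix: "bij quat_matrix"
proof (rule bijI)
  show "inj quat_matrix"
    by (rule injI) (auto simp: quat_matrix_def vec_eq_iff forall_2 quat_eq_iff)
  show "surj quat_matrix"
  proof (rule surjI)
    fix M :: "real^2^2"
    show "quat_matrix (Quat ((M$1$1 + M$2$2) / 2) ((M$1$2 - M$2$1) / 2)
            ((M$1$1 - M$2$2) / 2) (- (M$1$2 + M$2$1) / 2)) = M"
      by (simp add: quat_matrix_def vec_eq_iff forall_2 field_simps)
  qed
qed

lemma det_quat_matrix: "det (quat_matrix A) = qnorm A"
  by (simp add: quat_matrix_def qnorm_coeffs det_2 power2_eq_square algebra_simps)

lemma quat_matrix_SL2: "quat_matrix ` SL2 = {M. det M = 1}"
proof -
  have "M \<in> quat_matrix ` SL2" if "det M = 1" for M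
  proof -
    obtain A where "M = quat_matrix A"
      using bij_quat_matrix by (metis bij_pointE)
    with that show ?thesis
      by (auto simp: SL2_def det_quat_matrix)
  qed
  then show ?thesis
    by (auto simp: SL2_def det_quat_matrix)
qed

fun affine_act :: "quat \<times> quat \<Rightarrow> quat \<Rightarrow> quat" where
  "affine_act (v, A) u = v + A * u * qconj A"

definition affine_isom_group :: "(quat \<times> quat) monoid" where
  "affine_isom_group = \<lparr>carrier = pure_quats \<times> SL2,
     mult = (\<lambda>(v, A) (w, B). (v + A * w * qconj A, A * B)),
     one = (0, 1)\<rparr>"

lemma affine_act_mult:
  "affine_act (g \<otimes>\<^bsub>affine_isom_group\<^esub> h) u = affine_act g (affine_act h u)"
  by (cases g; cases h)
     (simp add: affine_isom_group_def qconj_mult distrib_left distrib_right mult.assoc)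

lemma pure_quats_sandwich: "u \<in> pure_quats \<Longrightarrow> A * u * qconj A \<in> pure_quats"
  by (simp add: pure_quats_def quat_defs algebra_simps)

lemma affine_act_isometry:
  assumes "g \<in> carrier affine_isom_group" "u \<in> pure_quats" "w \<in> pure_quats"
  shows "affine_act g u \<in> pure_quats"
    and "qnorm (affine_act g u - affine_act g w) = qnorm (u - w)"
proof -
  obtain v A where g: "g = (v, A)" "v \<in> pure_quats" "qnorm A = 1"
    using assms(1) by (auto simp: affine_isom_group_def SL2_def)
  show "affine_act g u \<in> pure_quats"
    using pure_quats_sandwich[OF assms(2), of A] g by (simp add: pure_quats_def plus_quat_def)
  have "affine_act g u - affine_act g w = A * (u - w) * qconj A"
    by (simp add: g algebra_simps)
  then show "qnorm (affine_act g u - affine_act g w) = qnorm (u - w)"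
    by (simp add: g qnorm_mult)
qed

lemma group_affine_isom_group: "group affine_isom_group"
proof (rule groupI, goal_cases)
  case (1 g h)
  then show ?case
    using pure_quats_sandwich
    by (auto simp: affine_isom_group_def SL2_def qnorm_mult pure_quats_def plus_quat_def)
next
  case 2
  then show ?case
    by (simp add: affine_isom_group_def SL2_def pure_quats_def zero_quat_def)
next
  case (3 g h k)
  then show ?case
    by (auto simp: affine_isom_group_def qconj_mult algebra_simps)
next
  case (4 g)
  have "qconj 1 = 1"
    by (simp add: quat_defs)
  with 4 show ?case
    by (auto simp: affine_isom_group_def)
next
  case (5 g)
  then obtain v A where g: "g = (v, A)" "v \<in> pure_quats" "qnorm A = 1"
    by (auto simp: affine_isom_group_def SL2_def)
  have "- (qconj A * v * A) \<in> pure_quats"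
    using pure_quats_sandwich[OF g(2), of "qconj A"] by (simp add: pure_quats_def uminus_quat_def)
  then have "(- (qconj A * v * A), qconj A) \<in> carrier affine_isom_group"
    using g by (simp add: affine_isom_group_def SL2_def)
  moreover have "(- (qconj A * v * A), qconj A) \<otimes>\<^bsub>affine_isom_group\<^esub> g
      = \<one>\<^bsub>affine_isom_group\<^esub>"
    using g by (simp add: affine_isom_group_def qconj_mult_self)
  ultimately show ?case
    by blast
qed

text \<open>
  Coordinates with respect to the ordered basis \<open>(-ij, j, i)\<close> of the pure quaternions,
  followed by the homogeneous coordinate \<open>1\<close>.
\<close>

definition affine_coords :: "quat \<Rightarrow> real^4" where
  "affine_coords u = vector [- coeff_ij u, coeff_j u, coeff_i u, 1]"

lemma affine_coords_basis:
  "affine_coords (X *\<^sub>R (- (quat_i * quat_j)) + Y *\<^sub>R quat_j + Z *\<^sub>R quat_i) = vector [X, Y, Z, 1]"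
  by (simp add: affine_coords_def quat_i_def quat_j_def quat_ops)

definition is_affine_matrix :: "real^4^4 \<Rightarrow> quat \<times> quat \<Rightarrow> bool" where
  "is_affine_matrix M g \<longleftrightarrow>
     (\<forall>u\<in>pure_quats. M *v affine_coords u = affine_coords (affine_act g u))"

text \<open>
  Words are lists of letters; \<open>(g, True)\<close> is the generator \<open>g\<close> and \<open>(g, False)\<close> its inverse.
  A relation \<open>u = v\<close> is the pair \<open>(u, v)\<close>.
\<close>

type_synonym 'g word = "('g \<times> bool) list"

inductive word_eq :: "('g word \<times> 'g word) set \<Rightarrow> 'g word \<Rightarrow> 'g word \<Rightarrow> bool"
  for R :: "('g word \<times> 'g word) set" where
  relator: "(u, v) \<in> R \<Longrightarrow> word_eq R u v"
| cancel: "word_eq R [(g, e), (g, \<not> e)] []"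
| refl: "word_eq R u u"
| sym: "word_eq R u v \<Longrightarrow> word_eq R v u"
| trans: "word_eq R u v \<Longrightarrow> word_eq R v w \<Longrightarrow> word_eq R u w"
| append: "word_eq R u u' \<Longrightarrow> word_eq R v v' \<Longrightarrow> word_eq R (u @ v) (u' @ v')"

definition word_class :: "('g word \<times> 'g word) set \<Rightarrow> 'g word \<Rightarrow> 'g word set" where
  "word_class R u = {v. word_eq R u v}"

definition presented_group :: "('g word \<times> 'g word) set \<Rightarrow> 'g word set monoid" where
  "presented_group R = \<lparr>carrier = range (word_class R),
     mult = (\<lambda>X Y. \<Union>u\<in>X. \<Union>v\<in>Y. word_class R (u @ v)),
     one = word_class R []\<rparr>"

lemma word_class_eq_iff: "word_class R u = word_class R v \<longleftrightarrow> word_eq R u v"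
proof
  assume "word_class R u = word_class R v"
  moreover have "v \<in> word_class R v"
    by (simp add: word_class_def word_eq.refl)
  ultimately show "word_eq R u v"
    by (simp add: word_class_def set_eq_iff)
next
  assume "word_eq R u v"
  then have "word_eq R u w \<longleftrightarrow> word_eq R v w" for w
    by (meson word_eq.sym word_eq.trans)
  then show "word_class R u = word_class R v"
    by (simp add: word_class_def)
qed

lemma mult_word_class:
  "word_class R u \<otimes>\<^bsub>presented_group R\<^esub> word_class R v = word_class R (u @ v)"
proof -
  have "word_class R (u' @ v') = word_class R (u @ v)"
    if "u' \<in> word_class R u" "v' \<in> word_class R v" for u' v'
  proof -
    from that have "word_eq R (u @ v) (u' @ v')"
      by (intro word_eq.append) (simp_all add: word_class_def)
    then show ?thesis
      unfolding word_class_eq_iff by (rule word_eq.sym)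
  qed
  then have "(\<Union>u'\<in>word_class R u. \<Union>v'\<in>word_class R v. word_class R (u' @ v'))
      = (\<Union>u'\<in>word_class R u. \<Union>v'\<in>word_class R v. word_class R (u @ v))"
    by (intro SUP_cong HOL.refl)
  moreover have "word_class R u \<noteq> {}" "word_class R v \<noteq> {}"
    using word_eq.refl by (auto simp: word_class_def)
  ultimately show ?thesis
    by (simp add: presented_group_def)
qed

lemma word_eq_left_inverse: "\<exists>v. word_eq R (v @ u) []"
proof (induction u)
  case Nil
  show ?case
    by (metis append_Nil word_eq.refl)
next
  case (Cons l u)
  then obtain v where v: "word_eq R (v @ u) []" by blast
  obtain g e where l: "l = (g, e)" by fastforce
  have "word_eq R ([(g, \<not> e)] @ [(g, e)]) []"
    using word_eq.cancel[of R g "\<not> e"] by simp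
  then have "word_eq R (v @ (([(g, \<not> e)] @ [(g, e)]) @ u)) (v @ ([] @ u))"
    by (intro word_eq.append word_eq.refl)
  then have "word_eq R ((v @ [(g, \<not> e)]) @ (l # u)) []"
    using word_eq.trans[OF _ v] by (simp add: l)
  then show ?case by blast
qed

lemma group_presented_group: "group (presented_group R)"
proof (rule groupI, goal_cases)
  case (1 X Y)
  then obtain u v where "X = word_class R u" "Y = word_class R v"
    by (auto simp: presented_group_def)
  then have "X \<otimes>\<^bsub>presented_group R\<^esub> Y = word_class R (u @ v)"
    by (simp only: mult_word_class)
  then show ?case
    by (simp add: presented_group_def)
next
  case 2
  then show ?case
    by (simp add: presented_group_def)
next
  case (3 X Y Z)
  then obtain u v w where "X = word_class R u" "Y = word_class R v" "Z = word_class R w"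
    by (auto simp: presented_group_def)
  then show ?case
    by (simp add: mult_word_class)
next
  case (4 X)
  then obtain u where "X = word_class R u"
    by (auto simp: presented_group_def)
  moreover have "\<one>\<^bsub>presented_group R\<^esub> = word_class R []"
    by (simp add: presented_group_def)
  ultimately show ?case
    by (simp add: mult_word_class)
next
  case (5 X)
  then obtain u where u: "X = word_class R u"
    by (auto simp: presented_group_def)
  obtain v where "word_eq R (v @ u) []"
    using word_eq_left_inverse by blast
  then have "word_class R v \<otimes>\<^bsub>presented_group R\<^esub> X = \<one>\<^bsub>presented_group R\<^esub>"
    unfolding u mult_word_class by (simp add: presented_group_def word_class_eq_iff)
  then show ?case
    by (auto simp: presented_group_def)
qed

datatype trefoil_gen = Gen_a | Gen_b

definition trefoil_rels :: "(trefoil_gen word \<times> trefoil_gen word) set" where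
  "trefoil_rels =
     {([(Gen_a, True), (Gen_b, True), (Gen_a, True)],
       [(Gen_b, True), (Gen_a, True), (Gen_b, True)])}"

definition trefoil_group :: "trefoil_gen word set monoid" where
  "trefoil_group = presented_group trefoil_rels"

definition trefoil_a :: "trefoil_gen word set" where
  "trefoil_a = word_class trefoil_rels [(Gen_a, True)]"

definition trefoil_b :: "trefoil_gen word set" where
  "trefoil_b = word_class trefoil_rels [(Gen_b, True)]"

definition conjugate_reps ::
  "(trefoil_gen word set \<Rightarrow> quat \<times> quat) \<Rightarrow> (trefoil_gen word set \<Rightarrow> quat \<times> quat) \<Rightarrow> bool" where
  "conjugate_reps \<rho> \<rho>' \<longleftrightarrow>
     (\<exists>g\<in>carrier affine_isom_group. \<forall>w\<in>carrier trefoil_group.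
        \<rho>' w = g \<otimes>\<^bsub>affine_isom_group\<^esub> \<rho> w \<otimes>\<^bsub>affine_isom_group\<^esub> inv\<^bsub>affine_isom_group\<^esub> g)"

definition has_form ::
  "(trefoil_gen word set \<Rightarrow> quat \<times> quat) \<Rightarrow> real \<Rightarrow> quat \<Rightarrow> quat \<Rightarrow> bool" where
  "has_form \<rho> s A B \<longleftrightarrow>
     \<rho> trefoil_a = (s *\<^sub>R pure_part A, A) \<and>
     \<rho> trefoil_b = (s *\<^sub>R pure_part B + pure_part (pure_part A * pure_part B), B)"

text \<open>
  The formal distance, angle and shift. Here \<open>u\<close> is \<open>N(A\<^sup>-)\<close>, which equals \<open>N(B\<^sup>-)\<close> when
  \<open>A\<close> and \<open>B\<close> have norm one and the same scalar part. The principal square root \<open>csqrt\<close> sends a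
  negative real to \<open>\<i>\<close> times the positive root of its absolute value. Only the cosine of the
  angle matters, so the branch chosen by \<open>Arccos\<close> is immaterial.
\<close>

definition form_y :: "quat \<Rightarrow> quat \<Rightarrow> real" where
  "form_y A B = - scal (pure_part A * pure_part B)"

definition axis_distance :: "quat \<Rightarrow> quat \<Rightarrow> complex" where
  "axis_distance A B =
     csqrt (complex_of_real ((qnorm (pure_part A))\<^sup>2 - (form_y A B)\<^sup>2)) / 2"

definition axis_angle :: "quat \<Rightarrow> quat \<Rightarrow> complex" where
  "axis_angle A B = Arccos (complex_of_real (form_y A B / qnorm (pure_part A)))"

definition axis_shift :: "real \<Rightarrow> quat \<Rightarrow> complex" where
  "axis_shift s A = complex_of_real s * csqrt (complex_of_real (qnorm (pure_part A)))"

lemma qnorm_pure_part: "A \<in> SL2 \<Longrightarrow> qnorm (pure_part A) = 1 - (scal A)\<^sup>2"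
  by (simp add: SL2_def qnorm_coeffs pure_part_def)

lemma axis_distance_alt:
  assumes "qnorm (pure_part B) = qnorm (pure_part A)"
  shows "axis_distance A B =
     csqrt (complex_of_real (qnorm (pure_part (pure_part A * pure_part B)))) / 2"
proof -
  have "(form_y A B)\<^sup>2 + qnorm (pure_part (pure_part A * pure_part B))
      = qnorm (pure_part A * pure_part B)"
    by (simp add: form_y_def qnorm_coeffs pure_part_def)
  also have "\<dots> = (qnorm (pure_part A))\<^sup>2"
    using assms by (simp add: qnorm_mult power2_eq_square)
  finally have "(qnorm (pure_part A))\<^sup>2 - (form_y A B)\<^sup>2
      = qnorm (pure_part (pure_part A * pure_part B))"
    by linarith
  then show ?thesis
    by (simp only: axis_distance_def)
qed

definition rep_A :: "real \<Rightarrow> quat" where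
  "rep_A x =
     (if x < 1 then Quat x (sqrt (1 - x^2)) 0 0
      else if x = 1 then Quat 1 1 1 0
      else Quat x 0 (sqrt (x^2 - 1)) 0)"

definition rep_B :: "real \<Rightarrow> quat" where
  "rep_B x =
     (if x < 1 then
        Quat x ((2 * x^2 - 1) / (2 * sqrt (1 - x^2))) (1/2 * sqrt ((4 * x^2 - 3) / (1 - x^2))) 0
      else if x = 1 then Quat 1 (1/4) (- (1/4)) 0
      else
        Quat x (- (1/2) * sqrt ((4 * x^2 - 3) / (x^2 - 1)))
          (- (2 * x^2 - 1) / (2 * sqrt (x^2 - 1))) 0)"

definition matrix_a :: "real \<Rightarrow> real^4^4" where
  "matrix_a x =
     (if x < 1 then vector
       [vector [2 * x^2 - 1, - 2 * x * sqrt (1 - x^2), 0, 0],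
        vector [2 * x * sqrt (1 - x^2), 2 * x^2 - 1, 0, 0],
        vector [0, 0, 1, (3 - 4 * x^2) * sqrt (1 - x^2) / (4 * x)],
        vector [0, 0, 0, 1]]
      else if x = 1 then vector
       [vector [1, -2, 2, 0],
        vector [2, -1, 2, - (1/4)],
        vector [2, -2, 3, - (1/4)],
        vector [0, 0, 0, 1]]
      else vector
       [vector [2 * x^2 - 1, 0, 2 * x * sqrt (x^2 - 1), 0],
        vector [0, 1, 0, (3 - 4 * x^2) * sqrt (x^2 - 1) / (4 * x)],
        vector [2 * x * sqrt (x^2 - 1), 0, 2 * x^2 - 1, 0],
        vector [0, 0, 0, 1]])"

definition matrix_b :: "real \<Rightarrow> real^4^4" where
  "matrix_b x =
     (if x < 1 then vector
       [vector [2 * x^2 - 1,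
                (x - 2 * x^3) / sqrt (1 - x^2),
                x * sqrt ((3 - 4 * x^2) / (x^2 - 1)),
                - (1/2) * sqrt (4 * x^2 - 3)],
        vector [x * (2 * x^2 - 1) / sqrt (1 - x^2),
                (1 + 2 * x^2 - 4 * x^4) / (2 - 2 * x^2),
                sqrt (4 * x^2 - 3) * (2 * x^2 - 1) / (2 * (1 - x^2)),
                - (sqrt ((4 * x^2 - 3)^3) / (8 * x * sqrt (1 - x^2)))],
        vector [x * sqrt ((3 - 4 * x^2) / (x^2 - 1)),
                - (sqrt (4 * x^2 - 3) * (2 * x^2 - 1) / (2 * (1 - x^2))),
                (1 - 2 * x^2) / (2 * x^2 - 2),
                (- 3 + 10 * x^2 - 8 * x^4) / (8 * x * sqrt (1 - x^2))],
        vector [0, 0, 0, 1]]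
      else if x = 1 then vector
       [vector [1, - (1/2), - (1/2), 1/2],
        vector [1/2, 7/8, - (1/8), 1/16],
        vector [- (1/2), 1/8, 9/8, - (1/16)],
        vector [0, 0, 0, 1]]
      else vector
       [vector [2 * x^2 - 1,
                x * sqrt ((4 * x^2 - 3) / (x^2 - 1)),
                - (x * (2 * x^2 - 1) / sqrt (x^2 - 1)),
                - (1/2) * sqrt (4 * x^2 - 3)],
        vector [- x * sqrt ((4 * x^2 - 3) / (x^2 - 1)),
                (1 - 2 * x^2) / (2 * x^2 - 2),
                sqrt (4 * x^2 - 3) * (2 * x^2 - 1) / (2 * (x^2 - 1)),
                (3 - 10 * x^2 + 8 * x^4) / (8 * x * sqrt (x^2 - 1))],
        vector [- (x * (2 * x^2 - 1) / sqrt (x^2 - 1)),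
                - (sqrt (4 * x^2 - 3) * (2 * x^2 - 1) / (2 * (x^2 - 1))),
                (1 + 2 * x^2 - 4 * x^4) / (2 - 2 * x^2),
                sqrt ((4 * x^2 - 3)^3) / (8 * x * sqrt (x^2 - 1))],
        vector [0, 0, 0, 1]])"

end

theory Submission
  imports Defs
begin

text \<open>
  For unit quaternions with common scalar part \<open>x\<close> and \<open>y = x\<^sup>2 - 1/2\<close> one has
  \<open>AB + qconj (AB) = 1\<close>, whence \<open>ABA = A + B - 2x = BAB\<close>.
  Put \<open>D = (A\<^sup>-B\<^sup>-)\<^sup>-\<close>. The difference of the translation parts of \<open>\<rho>(aba)\<close> and \<open>\<rho>(bab)\<close> is
  \<open>(4xs + 4x\<^sup>2 - 3) D\<close>, and \<open>D \<noteq> 0\<close> because \<open>N(D) = 3/4 - x\<^sup>2 < 0\<close>. So the affine braid relation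
  holds exactly for \<open>s = (3 - 4x\<^sup>2)/(4x)\<close>, which gives both existence and uniqueness.
\<close>

section \<open>Homomorphisms from presented groups\<close>

primrec word_eval :: "('a, 'm) monoid_scheme \<Rightarrow> ('g \<Rightarrow> 'a) \<Rightarrow> 'g word \<Rightarrow> 'a" where
  "word_eval G f [] = \<one>\<^bsub>G\<^esub>"
| "word_eval G f (l # u) = (if snd l then f (fst l) else inv\<^bsub>G\<^esub> f (fst l)) \<otimes>\<^bsub>G\<^esub> word_eval G f u"

context group
begin

lemma word_eval_closed [simp]:
  assumes "\<And>g. f g \<in> carrier G"
  shows "word_eval G f u \<in> carrier G"
  using assms by (induction u) auto

lemma word_eval_append:
  assumes "\<And>g. f g \<in> carrier G"
  shows "word_eval G f (u @ v) = word_eval G f u \<otimes> word_eval G f v"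
  using assms by (induction u) (auto simp: m_assoc)

text \<open>Evaluation is well defined on word classes: apart from \<open>relator\<close>, every
  rule of \<open>word_eq\<close> preserves values in any group, so only the relators have to be
  checked.\<close>

lemma word_eval_cong:
  assumes f: "\<And>g. f g \<in> carrier G"
    and R: "\<And>u v. (u, v) \<in> R \<Longrightarrow> word_eval G f u = word_eval G f v"
    and "word_eq R u v"
  shows "word_eval G f u = word_eval G f v"
  using assms(3)
proof (induction rule: word_eq.induct)
  case (cancel g e)
  then show ?case using f by (cases e) (auto simp: r_inv l_inv)
next
  case (append u u' v v')
  then show ?case using f by (simp add: word_eval_append)
qed (use R in auto)

text \<open>Existence half of the universal property (von Dyck): by \<open>word_eval_cong\<close>,
  evaluating a chosen representative of a class does not depend on the choice.\<close>

theorem presented_group_hom_exists: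
  assumes f: "\<And>g. f g \<in> carrier G"
    and R: "\<And>u v. (u, v) \<in> R \<Longrightarrow> word_eval G f u = word_eval G f v"
  obtains h where "h \<in> hom (presented_group R) G" "\<And>g. h (word_class R [(g, True)]) = f g"
proof
  define h where "h X = word_eval G f (SOME u. X = word_class R u)" for X
  have h: "h (word_class R u) = word_eval G f u" for u
  proof -
    have "word_class R u = word_class R (SOME v. word_class R u = word_class R v)"
      by (rule someI) (rule HOL.refl)
    then have "word_eq R u (SOME v. word_class R u = word_class R v)"
      by (simp only: word_class_eq_iff)
    from word_eval_cong[OF f R this] show ?thesis
      by (simp add: h_def)
  qed
  show "h \<in> hom (presented_group R) G"
  proof (rule homI)
    fix X Y
    assume "X \<in> carrier (presented_group R)" "Y \<in> carrier (presented_group R)"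
    then obtain u v where [simp]: "X = word_class R u" "Y = word_class R v"
      by (auto simp: presented_group_def)
    show "h X \<in> carrier G" by (simp add: h f)
    show "h (X \<otimes>\<^bsub>presented_group R\<^esub> Y) = h X \<otimes> h Y"
      by (simp add: mult_word_class h word_eval_append f)
  qed
  show "h (word_class R [(g, True)]) = f g" for g
    using f by (simp add: h)
qed

text \<open>The uniqueness half rests on this: induction on the word expresses a homomorphism
  through its values on the generators.\<close>

lemma hom_word_class:
  assumes h: "h \<in> hom (presented_group R) G"
  shows "h (word_class R u) = word_eval G (\<lambda>g. h (word_class R [(g, True)])) u"
proof -
  interpret h: group_hom "presented_group R" G h
    using h group_presented_group is_group
    by (auto simp: group_hom_def group_hom_axioms_def)
  have car: "word_class R v \<in> carrier (presented_group R)" for v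
    by (simp add: presented_group_def)
  have one: "\<one>\<^bsub>presented_group R\<^esub> = word_class R []"
    by (simp add: presented_group_def)
  \<comment> \<open>By \<open>cancel\<close>, the class of an inverse letter is a left inverse of
    the class of the generator, and \<open>h\<close> preserves this.\<close>
  have inv: "h (word_class R [(g, False)]) = inv h (word_class R [(g, True)])" for g
  proof -
    have "word_class R [(g, False)] \<otimes>\<^bsub>presented_group R\<^esub> word_class R [(g, True)]
        = \<one>\<^bsub>presented_group R\<^esub>"
      using word_eq.cancel[of R g False] by (simp add: mult_word_class one word_class_eq_iff)
    then have "h (word_class R [(g, False)]) \<otimes> h (word_class R [(g, True)]) = \<one>"
      using h.hom_mult[OF car car] h.hom_one by metis
    then show ?thesis
      using inv_equality car h.hom_closed by metis
  qed
  show ?thesis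
  proof (induction u)
    case Nil
    show ?case using h.hom_one by (simp add: one)
  next
    case (Cons l u)
    obtain g e where l: "l = (g, e)" by fastforce
    have "h (word_class R (l # u)) = h (word_class R [l]) \<otimes> h (word_class R u)"
      using h.hom_mult[OF car car, of "[l]" u] by (simp add: mult_word_class)
    then show ?case
      using Cons inv by (cases e) (auto simp: l)
  qed
qed

theorem presented_group_hom_unique:
  assumes h: "h \<in> hom (presented_group R) G" and h': "h' \<in> hom (presented_group R) G"
    and eq: "\<And>g. h (word_class R [(g, True)]) = h' (word_class R [(g, True)])"
    and "X \<in> carrier (presented_group R)"
  shows "h X = h' X"
proof -
  obtain u where "X = word_class R u"
    using assms(4) by (auto simp: presented_group_def)
  then show ?thesis
    using hom_word_class[OF h, of u] hom_word_class[OF h', of u] eq by simp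
qed

lemma conjugate_hom:
  assumes h: "h \<in> hom K G" and g: "g \<in> carrier G"
  shows "(\<lambda>w. g \<otimes> h w \<otimes> inv g) \<in> hom K G"
proof (rule homI)
  fix u v
  assume uv: "u \<in> carrier K" "v \<in> carrier K"
  then have c: "h u \<in> carrier G" "h v \<in> carrier G"
    using h by (auto simp: hom_def)
  show "g \<otimes> h u \<otimes> inv g \<in> carrier G"
    using c g by simp
  have "inv g \<otimes> (g \<otimes> (h v \<otimes> inv g)) = h v \<otimes> inv g"
    using c g by (simp add: m_assoc[symmetric])
  then show "g \<otimes> h (u \<otimes>\<^bsub>K\<^esub> v) \<otimes> inv g = (g \<otimes> h u \<otimes> inv g) \<otimes> (g \<otimes> h v \<otimes> inv g)"
    using c g hom_mult[OF h uv] by (simp add: m_assoc)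
qed

text \<open>Stated with \<open>inv (inv g)\<close> because the uniqueness proof conjugates by
  \<open>inv g\<close> and then back by \<open>g\<close>.\<close>

lemma conjugate_cancel:
  assumes "g \<in> carrier G" "h \<in> carrier G"
  shows "inv g \<otimes> (g \<otimes> h \<otimes> inv g) \<otimes> inv (inv g) = h"
    and "g \<otimes> (inv g \<otimes> h \<otimes> inv (inv g)) \<otimes> inv g = h"
proof -
  have "inv k \<otimes> (k \<otimes> h \<otimes> inv k) \<otimes> k = h" if "k \<in> carrier G" for k
  proof -
    have "inv k \<otimes> (k \<otimes> h \<otimes> inv k) \<otimes> k = (inv k \<otimes> k) \<otimes> h \<otimes> (inv k \<otimes> k)"
      using that assms(2) by (simp only: m_assoc m_closed inv_closed)
    then show ?thesis
      using that assms(2) by simp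
  qed
  from this[of g] this[of "inv g"] assms
  show "inv g \<otimes> (g \<otimes> h \<otimes> inv g) \<otimes> inv (inv g) = h"
    and "g \<otimes> (inv g \<otimes> h \<otimes> inv (inv g)) \<otimes> inv g = h"
    by auto
qed

end

section \<open>Homomorphisms out of the trefoil group\<close>

lemma trefoil_hom_exists:
  assumes "group G" "\<alpha> \<in> carrier G" "\<beta> \<in> carrier G"
    and "\<alpha> \<otimes>\<^bsub>G\<^esub> (\<beta> \<otimes>\<^bsub>G\<^esub> \<alpha>) = \<beta> \<otimes>\<^bsub>G\<^esub> (\<alpha> \<otimes>\<^bsub>G\<^esub> \<beta>)"
  obtains h where "h \<in> hom trefoil_group G" "h trefoil_a = \<alpha>" "h trefoil_b = \<beta>"
proof -
  interpret group G by fact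
  define f where "f g = (case g of Gen_a \<Rightarrow> \<alpha> | Gen_b \<Rightarrow> \<beta>)" for g
  have f: "f g \<in> carrier G" for g
    using assms by (cases g) (auto simp: f_def)
  obtain h where h: "h \<in> hom (presented_group trefoil_rels) G"
    "\<And>g. h (word_class trefoil_rels [(g, True)]) = f g"
    \<comment> \<open>The assumed relation is bracketed to the right, exactly as
      \<open>word_eval\<close> multiplies out a word.\<close>
    using presented_group_hom_exists[of f trefoil_rels] f assms
    by (auto simp: trefoil_rels_def f_def)
  show thesis
    using that[of h] h
    by (simp add: trefoil_group_def trefoil_a_def trefoil_b_def f_def)
qed

lemma trefoil_generators:
  "trefoil_a \<in> carrier trefoil_group" "trefoil_b \<in> carrier trefoil_group"
  by (simp_all add: trefoil_group_def trefoil_a_def trefoil_b_def presented_group_def)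

lemma trefoil_relation:
  assumes h: "h \<in> hom trefoil_group G"
  shows "h trefoil_a \<otimes>\<^bsub>G\<^esub> (h trefoil_b \<otimes>\<^bsub>G\<^esub> h trefoil_a)
    = h trefoil_b \<otimes>\<^bsub>G\<^esub> (h trefoil_a \<otimes>\<^bsub>G\<^esub> h trefoil_b)"
proof -
  interpret T: group trefoil_group
    unfolding trefoil_group_def by (rule group_presented_group)
  have "trefoil_a \<otimes>\<^bsub>trefoil_group\<^esub> (trefoil_b \<otimes>\<^bsub>trefoil_group\<^esub> trefoil_a)
      = trefoil_b \<otimes>\<^bsub>trefoil_group\<^esub> (trefoil_a \<otimes>\<^bsub>trefoil_group\<^esub> trefoil_b)"
    by (simp add: trefoil_group_def trefoil_a_def trefoil_b_def mult_word_class
        word_class_eq_iff trefoil_rels_def word_eq.relator)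
  then show ?thesis
    by (metis (no_types) hom_mult[OF h] trefoil_generators T.m_closed)
qed

lemma trefoil_hom_unique:
  assumes "group G" "h \<in> hom trefoil_group G" "h' \<in> hom trefoil_group G"
    and "h trefoil_a = h' trefoil_a" "h trefoil_b = h' trefoil_b"
    and "w \<in> carrier trefoil_group"
  shows "h w = h' w"
proof -
  have "h (word_class trefoil_rels [(g, True)]) = h' (word_class trefoil_rels [(g, True)])" for g
    using assms(4,5) by (cases g) (simp_all add: trefoil_a_def trefoil_b_def)
  then show ?thesis
    using group.presented_group_hom_unique[OF assms(1)] assms(2,3,6)
    unfolding trefoil_group_def by blast
qed

section \<open>The braid relation for affine isometries\<close>

lemma qconj_eq: "qconj A = (scal A + scal A) *\<^sub>R 1 - A"
  by (simp add: quat_defs quat_eq_iff)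

lemma pure_part_eq: "pure_part A = A - scal A *\<^sub>R 1"
  by (simp add: quat_defs quat_eq_iff)

text \<open>The scalar part of \<open>A\<close> contributes a multiple of
  \<open>C * qconj C\<close>, which is a scalar, and the sandwich of a pure quaternion is
  pure.\<close>

lemma pure_part_conjugate: "pure_part (C * A * qconj C) = C * pure_part A * qconj C"
  by (simp add: quat_defs quat_eq_iff algebra_simps)

text \<open>Scalars commute, and \<open>B^- A^-\<close> is the conjugate of \<open>A^- B^-\<close>;
  subtraction cancels the scalar parts and doubles the pure part.\<close>

lemma pure_product_commutator:
  "2 *\<^sub>R pure_part (pure_part A * pure_part B) = A * B - B * A"
  by (simp add: quat_defs quat_eq_iff algebra_simps)

text \<open>The pure part of \<open>A\<^sup>- B\<^sup>-\<close> is orthogonal to, hence anticommutes with, \<open>A\<^sup>-\<close> and \<open>B\<^sup>-\<close>.\<close>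

lemma pure_product_anticommute:
  defines "D \<equiv> \<lambda>A B. pure_part (pure_part A * pure_part B)"
  shows "D A B * qconj A = A * D A B" "D A B * qconj B = B * D A B"
  by (simp_all add: D_def quat_defs quat_eq_iff algebra_simps)

text \<open>Multiplicativity of the norm on \<open>A^- B^-\<close>, whose scalar part is
  \<open>- form_y A B\<close>: the Minkowski form of Lagrange's identity.\<close>

lemma qnorm_pure_product:
  "qnorm (pure_part (pure_part A * pure_part B))
    = qnorm (pure_part A) * qnorm (pure_part B) - (form_y A B)\<^sup>2"
proof -
  have "(form_y A B)\<^sup>2 + qnorm (pure_part (pure_part A * pure_part B))
      = qnorm (pure_part A * pure_part B)"
    by (simp add: form_y_def qnorm_coeffs pure_part_def)
  then show ?thesis
    by (simp add: qnorm_mult)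
qed

text \<open>Since \<open>scal (A * B) = x^2 - form_y A B\<close>, the condition \<open>form\<close>
  says that \<open>A * B\<close> has trace 1, which forces the braid relation below.\<close>

locale braided_pair =
  fixes A B :: quat and x :: real
  assumes SL2: "A \<in> SL2" "B \<in> SL2"
    and scal: "scal A = x" "scal B = x"
    and form: "form_y A B = x\<^sup>2 - 1 / 2"
begin

lemma swap: "braided_pair B A x"
  using SL2 scal form by unfold_locales (simp_all add: form_y_def quat_defs algebra_simps)

lemma mult_qconj: "A * qconj A = 1" "qconj A * A = 1"
  using SL2 by (simp_all add: qnorm_eq qconj_mult_self SL2_def)

text \<open>Cayley-Hamilton for trace \<open>2 * x\<close> and norm 1.\<close>

lemma square_eq: "A * A = (x + x) *\<^sub>R A - 1"
  using mult_qconj(1) unfolding qconj_eq scal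
  by (simp add: algebra_simps)

text \<open>The left side is the trace of \<open>A * B\<close>, namely
  \<open>2 * (x^2 - form_y A B)\<close>.\<close>

lemma product_plus_qconj: "A * B + qconj B * qconj A = 1"
  using form scal
  by (simp add: form_y_def quat_defs quat_eq_iff power2_eq_square algebra_simps)

lemma triple_eq: "A * B * A = A + B - (x + x) *\<^sub>R 1"
proof -
  have "A * B * A = (1 - qconj B * qconj A) * A"
    by (simp add: product_plus_qconj[symmetric])
  also have "\<dots> = A - qconj B * (qconj A * A)"
    by (simp only: left_diff_distrib mult.assoc mult_1_left)
  finally show ?thesis
    unfolding mult_qconj by (simp add: qconj_eq scal)
qed

lemma braid: "A * B * A = B * A * B"
  using triple_eq braided_pair.triple_eq[OF swap] by simp

abbreviation (input) D :: quat where
  "D \<equiv> pure_part (pure_part A * pure_part B)"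

text \<open>Apart from \<open>A * B\<close>, the right side is symmetric in \<open>A\<close> and
  \<open>B\<close>. Exchanging them and subtracting therefore leaves only the commutator, a multiple
  of \<open>D\<close>.\<close>

lemma conjugate_pure_eq:
  "A * pure_part B * qconj A = (x + x) *\<^sub>R (A * B) - (A + B) + x *\<^sub>R 1"
proof -
  have "A * pure_part B * qconj A = A * B * qconj A - x *\<^sub>R (A * qconj A)"
    by (simp add: pure_part_eq scal algebra_simps)
  also have "A * B * qconj A = (x + x) *\<^sub>R (A * B) - A * B * A"
    by (simp add: qconj_eq[of A] scal right_diff_distrib)
  finally show ?thesis
    by (simp only: triple_eq mult_qconj scaleR_left_distrib) simp
qed

lemma conjugate_pure_diff:
  "A * pure_part B * qconj A - B * pure_part A * qconj B = (4 * x) *\<^sub>R D"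
proof -
  have "A * pure_part B * qconj A - B * pure_part A * qconj B
      = (x + x) *\<^sub>R (A * B - B * A)"
    unfolding conjugate_pure_eq braided_pair.conjugate_pure_eq[OF swap]
    by (simp add: algebra_simps)
  also have "\<dots> = (4 * x) *\<^sub>R D"
    by (simp add: pure_product_commutator[symmetric])
  finally show ?thesis .
qed

text \<open>This is the part of the translation difference that is free of \<open>s\<close>. Moving
  \<open>D\<close> to the right by anticommutation turns the sandwiches into left multiplications,
  and the left factor collapses to a scalar by \<open>square_eq\<close> and
  \<open>triple_eq\<close>.\<close>

lemma conjugate_product_diff:
  "A * D * qconj A - D - B * A * D * qconj (B * A) = (4 * x\<^sup>2 - 3) *\<^sub>R D"
proof -
  define c where "c = x + x"
  note anti = pure_product_anticommute[of A B]
  have "B * A * D * qconj (B * A) = B * A * (D * qconj A) * qconj B"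
    by (simp only: qconj_mult mult.assoc)
  also have "\<dots> = B * A * A * (D * qconj B)"
    by (simp only: anti mult.assoc)
  also have "\<dots> = B * (A * A) * B * D"
    by (simp only: anti mult.assoc)
  finally have "A * D * qconj A - D - B * A * D * qconj (B * A)
      = (A * A - 1 - B * (A * A) * B) * D"
    by (simp only: mult.assoc anti left_diff_distrib mult_1_left)
  also have "B * (A * A) * B = c *\<^sub>R (B * A * B) - B * B"
    by (simp add: square_eq c_def[symmetric] algebra_simps)
  also have "\<dots> = c *\<^sub>R (B + A - c *\<^sub>R 1) - (c *\<^sub>R B - 1)"
    unfolding braided_pair.triple_eq[OF swap] braided_pair.square_eq[OF swap] c_def ..
  also have "A * A - 1 - (c *\<^sub>R (B + A - c *\<^sub>R 1) - (c *\<^sub>R B - 1)) = (4 * x\<^sup>2 - 3) *\<^sub>R 1"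
    unfolding square_eq c_def by (simp add: quat_ops quat_eq_iff power2_eq_square algebra_simps)
  finally show ?thesis
    by simp
qed

text \<open>The braid relation says that \<open>A * B\<close> conjugates \<open>A\<close> to
  \<open>B\<close>; it remains to take pure parts.\<close>

lemma conjugate_by_product: "A * B * pure_part A * qconj (A * B) = pure_part B"
proof -
  have "A * B * A * qconj (A * B) = B * (A * B * qconj (A * B))"
    by (simp only: braid) (simp only: mult.assoc)
  also have "A * B * qconj (A * B) = 1"
    using SL2 by (simp add: qnorm_eq qnorm_mult SL2_def)
  finally show ?thesis
    using pure_part_conjugate[of "A * B" A] by simp
qed

lemma D_nonzero:
  assumes "4 * x\<^sup>2 \<noteq> 3"
  shows "D \<noteq> 0"
proof
  assume "D = 0"
  then have "qnorm D = 0"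
    by (simp only:) (simp add: qnorm_coeffs zero_quat_def)
  then have "(1 - x\<^sup>2)\<^sup>2 - (x\<^sup>2 - 1 / 2)\<^sup>2 = 0"
    using qnorm_pure_product[of A B] SL2 scal form
    by (simp add: qnorm_pure_part power2_eq_square[of "1 - x\<^sup>2"])
  then have "4 * x\<^sup>2 = 3"
    by (simp add: power2_eq_square algebra_simps)
  with assms show False ..
qed

text \<open>The linear parts agree by \<open>braid\<close>. The translation parts differ by a scalar
  multiple of the nonzero \<open>D\<close>, so they agree exactly when that scalar vanishes.\<close>

theorem affine_braid_iff:
  fixes s :: real
  assumes "4 * x\<^sup>2 \<noteq> 3"
  defines "\<alpha> \<equiv> (s *\<^sub>R pure_part A, A)" and "\<beta> \<equiv> (s *\<^sub>R pure_part B + D, B)"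
  shows "\<alpha> \<otimes>\<^bsub>affine_isom_group\<^esub> (\<beta> \<otimes>\<^bsub>affine_isom_group\<^esub> \<alpha>)
      = \<beta> \<otimes>\<^bsub>affine_isom_group\<^esub> (\<alpha> \<otimes>\<^bsub>affine_isom_group\<^esub> \<beta>)
    \<longleftrightarrow> 4 * x * s = 3 - 4 * x\<^sup>2"
proof -
  \<comment> \<open>\<open>?l\<close> and \<open>?r\<close> are the translation parts of the two
    triple products, bracketed as the group law unfolds them.\<close>
  let ?l = "s *\<^sub>R pure_part A + A * (s *\<^sub>R pure_part B + D + B * (s *\<^sub>R pure_part A) * qconj B) * qconj A"
  let ?r = "s *\<^sub>R pure_part B + D + B * (s *\<^sub>R pure_part A + A * (s *\<^sub>R pure_part B + D) * qconj A) * qconj B"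
  have "?l = s *\<^sub>R (pure_part A + A * pure_part B * qconj A + A * B * pure_part A * qconj (A * B))
      + A * D * qconj A"
    by (simp add: qconj_mult algebra_simps)
  moreover have "?r = s *\<^sub>R (pure_part B + B * pure_part A * qconj B + B * A * pure_part B * qconj (B * A))
      + (D + B * A * D * qconj (B * A))"
    by (simp add: qconj_mult algebra_simps)
  \<comment> \<open>By \<open>conjugate_by_product\<close> and its mirror image, both brackets
    contain \<open>pure_part A + pure_part B\<close>, which cancels.\<close>
  ultimately have "?l - ?r = s *\<^sub>R (A * pure_part B * qconj A - B * pure_part A * qconj B)
      + (A * D * qconj A - D - B * A * D * qconj (B * A))"
    using conjugate_by_product braided_pair.conjugate_by_product[OF swap]
    by (simp add: algebra_simps)
  also have "\<dots> = (4 * x * s - (3 - 4 * x\<^sup>2)) *\<^sub>R D"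
    unfolding conjugate_pure_diff conjugate_product_diff
    by (simp add: algebra_simps)
  finally have "?l = ?r \<longleftrightarrow> 4 * x * s = 3 - 4 * x\<^sup>2"
    using D_nonzero[OF assms(1)] by (metis eq_iff_diff_eq_0 scaleR_eq_0_iff)
  then show ?thesis
    using braid by (simp add: \<alpha>_def \<beta>_def affine_isom_group_def mult.assoc)
qed

end

section \<open>Conjugation by isometries fixing the origin\<close>

lemma linear_conjugate:
  assumes "C \<in> SL2"
  shows "(0, C) \<in> carrier affine_isom_group"
    and "(0, C) \<otimes>\<^bsub>affine_isom_group\<^esub> (v, A) \<otimes>\<^bsub>affine_isom_group\<^esub> inv\<^bsub>affine_isom_group\<^esub> (0, C)
      = (C * v * qconj C, C * A * qconj C)"
proof -
  have car: "(0, E) \<in> carrier affine_isom_group" if "E \<in> SL2" for E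
    using that by (simp add: affine_isom_group_def pure_quats_def zero_quat_def)
  show "(0, C) \<in> carrier affine_isom_group"
    using assms by (rule car)
  have "inv\<^bsub>affine_isom_group\<^esub> (0, C) = (0, qconj C)"
  proof (rule group.inv_equality[OF group_affine_isom_group])
    show "(0, qconj C) \<otimes>\<^bsub>affine_isom_group\<^esub> (0, C) = \<one>\<^bsub>affine_isom_group\<^esub>"
      using assms by (simp add: affine_isom_group_def qconj_mult_self SL2_def)
  qed (use assms car in \<open>auto simp: SL2_def\<close>)
  then show "(0, C) \<otimes>\<^bsub>affine_isom_group\<^esub> (v, A) \<otimes>\<^bsub>affine_isom_group\<^esub> inv\<^bsub>affine_isom_group\<^esub> (0, C)
      = (C * v * qconj C, C * A * qconj C)"
    by (simp add: affine_isom_group_def)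
qed

text \<open>Conjugation by \<open>(0, C)\<close> carries the prescribed form for \<open>A\<close>,
  \<open>B\<close> to that for their conjugates with the same \<open>s\<close>, because inner
  factors \<open>qconj C * C\<close> cancel in products.\<close>

lemma conjugate_form:
  assumes C: "C \<in> SL2"
  shows "(0, C) \<otimes>\<^bsub>affine_isom_group\<^esub> (s *\<^sub>R pure_part A, A) \<otimes>\<^bsub>affine_isom_group\<^esub> inv\<^bsub>affine_isom_group\<^esub> (0, C)
      = (s *\<^sub>R pure_part (C * A * qconj C), C * A * qconj C)" (is ?a)
    and "(0, C) \<otimes>\<^bsub>affine_isom_group\<^esub> (s *\<^sub>R pure_part B + pure_part (pure_part A * pure_part B), B)
        \<otimes>\<^bsub>affine_isom_group\<^esub> inv\<^bsub>affine_isom_group\<^esub> (0, C)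
      = (s *\<^sub>R pure_part (C * B * qconj C)
          + pure_part (pure_part (C * A * qconj C) * pure_part (C * B * qconj C)), C * B * qconj C)" (is ?b)
proof -
  show ?a
    by (simp add: linear_conjugate(2)[OF C] pure_part_conjugate)
  have "pure_part (C * A * qconj C) * pure_part (C * B * qconj C)
      = C * pure_part A * (qconj C * C) * pure_part B * qconj C"
    by (simp only: pure_part_conjugate) (simp only: mult.assoc)
  also have "\<dots> = C * (pure_part A * pure_part B) * qconj C"
    using C by (simp add: qconj_mult_self SL2_def mult.assoc)
  finally show ?b
    by (simp add: linear_conjugate(2)[OF C] pure_part_conjugate distrib_left distrib_right)
qed

text \<open>One shape for both generators: \<open>r = 0\<close> gives the image of \<open>a\<close>,
  and \<open>r = 1\<close> with \<open>Q\<close> the product of the pure parts gives that of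
  \<open>b\<close>.\<close>

lemma form_in_carrier:
  assumes "A \<in> SL2"
  shows "(s *\<^sub>R pure_part B + r *\<^sub>R pure_part Q, A) \<in> carrier affine_isom_group"
  using assms by (simp add: affine_isom_group_def pure_quats_def quat_ops pure_part_def)

section \<open>Existence, uniqueness and the axes of the representation\<close>

context braided_pair
begin

theorem trefoil_rep:
  assumes "x \<noteq> 0" "4 * x\<^sup>2 \<noteq> 3"
  shows "\<exists>\<rho>\<in>hom trefoil_group affine_isom_group. has_form \<rho> ((3 - 4 * x\<^sup>2) / (4 * x)) A B"
proof -
  let ?s = "(3 - 4 * x\<^sup>2) / (4 * x)"
  have "4 * x * ?s = 3 - 4 * x\<^sup>2"
    using assms by simp
  moreover have "(?s *\<^sub>R pure_part A, A) \<in> carrier affine_isom_group"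
    "(?s *\<^sub>R pure_part B + D, B) \<in> carrier affine_isom_group"
    using form_in_carrier[OF SL2(1), of ?s A 0] form_in_carrier[OF SL2(2), of ?s B 1] by simp_all
  ultimately obtain \<rho> where "\<rho> \<in> hom trefoil_group affine_isom_group"
    "\<rho> trefoil_a = (?s *\<^sub>R pure_part A, A)" "\<rho> trefoil_b = (?s *\<^sub>R pure_part B + D, B)"
    using trefoil_hom_exists[OF group_affine_isom_group] affine_braid_iff[OF assms(2), of ?s]
    by metis
  then show ?thesis
    by (auto simp: has_form_def)
qed

text \<open>Conjugating \<open>\<rho>'\<close> back by \<open>(0, C)\<close> gives a representation
  \<open>\<psi>\<close> of the form for \<open>A\<close>, \<open>B\<close> themselves. The braid
  relation determines the parameter, so \<open>\<psi>\<close> and \<open>\<rho>\<close> agree on the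
  generators and hence everywhere.\<close>

theorem trefoil_rep_unique:
  assumes nz: "4 * x\<^sup>2 \<noteq> 3" "x \<noteq> 0"
    and \<rho>: "\<rho> \<in> hom trefoil_group affine_isom_group" "has_form \<rho> s A B"
    and \<rho>': "\<rho>' \<in> hom trefoil_group affine_isom_group"
      "has_form \<rho>' s' (C * A * qconj C) (C * B * qconj C)"
    and C: "C \<in> SL2"
  shows "conjugate_reps \<rho> \<rho>'"
proof -
  interpret L: group affine_isom_group by (rule group_affine_isom_group)
  let ?g = "(0, C)"
  let ?h = "inv\<^bsub>affine_isom_group\<^esub> ?g"
  define \<psi> where "\<psi> w = ?h \<otimes>\<^bsub>affine_isom_group\<^esub> \<rho>' w \<otimes>\<^bsub>affine_isom_group\<^esub> inv\<^bsub>affine_isom_group\<^esub> ?h" for w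
  have g: "?g \<in> carrier affine_isom_group"
    using linear_conjugate(1)[OF C] .
  then have \<psi>: "\<psi> \<in> hom trefoil_group affine_isom_group"
    unfolding \<psi>_def[abs_def] using \<rho>'(1) by (intro L.conjugate_hom) auto
  have car: "(s' *\<^sub>R pure_part A, A) \<in> carrier affine_isom_group"
    "(s' *\<^sub>R pure_part B + D, B) \<in> carrier affine_isom_group"
    using form_in_carrier[OF SL2(1), of s' A 0] form_in_carrier[OF SL2(2), of s' B 1] by simp_all
  have form: "has_form \<psi> s' A B"
    using \<rho>'(2) L.conjugate_cancel(1)[OF g car(1)] L.conjugate_cancel(1)[OF g car(2)]
    unfolding has_form_def \<psi>_def conjugate_form[OF C] by simp
  have "4 * x * s = 3 - 4 * x\<^sup>2" "4 * x * s' = 3 - 4 * x\<^sup>2"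
    using trefoil_relation[OF \<rho>(1)] trefoil_relation[OF \<psi>] \<rho>(2) form affine_braid_iff[OF nz(1)]
    by (simp_all add: has_form_def)
  then have "4 * x * s = 4 * x * s'"
    by simp
  with nz have "s = s'"
    by simp
  have "\<rho>' w = ?g \<otimes>\<^bsub>affine_isom_group\<^esub> \<rho> w \<otimes>\<^bsub>affine_isom_group\<^esub> ?h"
    if w: "w \<in> carrier trefoil_group" for w
  proof -
    have "\<rho> w = \<psi> w"
      using trefoil_hom_unique[OF L.is_group \<rho>(1) \<psi> _ _ w] \<rho>(2) form \<open>s = s'\<close>
      by (simp add: has_form_def)
    moreover have "\<rho>' w \<in> carrier affine_isom_group"
      using \<rho>'(1) w by (auto simp: hom_def)
    ultimately show ?thesis
      using L.conjugate_cancel(2)[OF g, of "\<rho>' w"] by (simp add: \<psi>_def)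
  qed
  then show ?thesis
    using g by (auto simp: conjugate_reps_def)
qed

lemma axis_distance_eq: "axis_distance A B = csqrt (complex_of_real (3 - 4 * x\<^sup>2)) / 4"
proof -
  have "(1 - x\<^sup>2)\<^sup>2 - (x\<^sup>2 - 1 / 2)\<^sup>2 = (3 - 4 * x\<^sup>2) / 4"
    by (simp add: power2_eq_square algebra_simps)
  then have "axis_distance A B = csqrt (complex_of_real ((3 - 4 * x\<^sup>2) / 4)) / 2"
    using SL2 scal form by (simp only: axis_distance_def qnorm_pure_part)
  \<comment> \<open>\<open>csqrt\<close> is not multiplicative in general, but on reals only the
    sign decides between the factors 1 and \<i>, so the positive factor 1/4 can be pulled
    out.\<close>
  also have "csqrt (complex_of_real ((3 - 4 * x\<^sup>2) / 4)) = csqrt (complex_of_real (3 - 4 * x\<^sup>2)) / 2"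
    unfolding csqrt_of_real' by (simp add: real_sqrt_divide)
  finally show ?thesis
    by simp
qed

text \<open>\<open>cos\<close> inverts the complex \<open>Arccos\<close> at every argument, so the
  quotient may exceed 1 in absolute value.\<close>

lemma cos_axis_angle_eq:
  "cos (axis_angle A B) = complex_of_real ((2 * x\<^sup>2 - 1) / (2 - 2 * x\<^sup>2))"
proof -
  have "(x\<^sup>2 - 1 / 2) / (1 - x\<^sup>2) = (2 * (x\<^sup>2 - 1 / 2)) / (2 * (1 - x\<^sup>2))"
    by (rule mult_divide_mult_cancel_left[symmetric]) simp
  then show ?thesis
    using SL2 scal form by (simp add: axis_angle_def qnorm_pure_part right_diff_distrib)
qed

end

section \<open>Affine matrices\<close>

lemma vector_4 [simp]:
  "(vector [a, b, c, d] :: ('a::zero)^4) $ 1 = a"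
  "(vector [a, b, c, d] :: ('a::zero)^4) $ 2 = b"
  "(vector [a, b, c, d] :: ('a::zero)^4) $ 3 = c"
  "(vector [a, b, c, d] :: ('a::zero)^4) $ 4 = d"
  unfolding vector_def by simp_all

text \<open>No quaternion in the three families has an \<open>ij\<close> component, so this general
  matrix serves every case. The order and the sign in the last column come from the basis
  \<open>(-ij, j, i)\<close>.\<close>

lemma is_affine_matrix_planar:
  "is_affine_matrix
    (vector [vector [x\<^sup>2 - a\<^sup>2 + b\<^sup>2, - 2 * x * a, 2 * x * b, - v3],
             vector [2 * x * a, x\<^sup>2 - a\<^sup>2 - b\<^sup>2, 2 * a * b, v2],
             vector [2 * x * b, - 2 * a * b, x\<^sup>2 + a\<^sup>2 + b\<^sup>2, v1],
             vector [0, 0, 0, 1]])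
    (Quat 0 v1 v2 v3, Quat x a b 0)"
  by (auto simp: is_affine_matrix_def pure_quats_def affine_coords_def vec_eq_iff forall_4 sum_4
      matrix_vector_mult_def quat_defs power2_eq_square algebra_simps)

text \<open>Reduces a given matrix to twelve scalar equations, listed row by row; the numbered cases
  below follow this order.\<close>

lemma is_affine_matrix_planarI:
  assumes "g = (Quat 0 v1 v2 v3, Quat x a b 0)"
    and "m11 = x\<^sup>2 - a\<^sup>2 + b\<^sup>2" "m12 = - 2 * x * a" "m13 = 2 * x * b" "m14 = - v3"
    and "m21 = 2 * x * a" "m22 = x\<^sup>2 - a\<^sup>2 - b\<^sup>2" "m23 = 2 * a * b" "m24 = v2"
    and "m31 = 2 * x * b" "m32 = - 2 * a * b" "m33 = x\<^sup>2 + a\<^sup>2 + b\<^sup>2" "m34 = v1"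
  shows "is_affine_matrix
    (vector [vector [m11, m12, m13, m14], vector [m21, m22, m23, m24],
             vector [m31, m32, m33, m34], vector [0, 0, 0, 1]]) g"
  unfolding assms by (rule is_affine_matrix_planar)

text \<open>The pure part of a product of two combinations of \<open>i\<close> and \<open>j\<close>
  is a multiple of \<open>ij\<close>, with the determinant \<open>a * d - b * c\<close> as
  coefficient.\<close>

lemma has_form_planar:
  assumes "has_form \<rho> s (Quat x a b 0) (Quat x c d 0)"
  shows "\<rho> trefoil_a = (Quat 0 (s * a) (s * b) 0, Quat x a b 0)"
    and "\<rho> trefoil_b = (Quat 0 (s * c) (s * d) (a * d - b * c), Quat x c d 0)"
  using assms by (simp_all add: has_form_def quat_defs)

lemma braided_pair_planar:
  assumes "x\<^sup>2 + a\<^sup>2 - b\<^sup>2 = 1" "x\<^sup>2 + c\<^sup>2 - d\<^sup>2 = 1" "a * c - b * d = x\<^sup>2 - 1 / 2"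
  shows "braided_pair (Quat x a b 0) (Quat x c d 0) x"
  using assms by unfold_locales (simp_all add: SL2_def qnorm_coeffs form_y_def quat_defs)

section \<open>The elliptic, hyperbolic and parabolic families\<close>

lemma rep_elliptic:
  assumes "3 < 4 * x\<^sup>2" "0 < x" "x < 1"
  defines "s \<equiv> (3 - 4 * x\<^sup>2) / (4 * x)"
  shows "braided_pair (rep_A x) (rep_B x) x"
    and "has_form \<rho> s (rep_A x) (rep_B x) \<Longrightarrow> is_affine_matrix (matrix_a x) (\<rho> trefoil_a)"
    and "has_form \<rho> s (rep_A x) (rep_B x) \<Longrightarrow> is_affine_matrix (matrix_b x) (\<rho> trefoil_b)"
proof -
  \<comment> \<open>Naming the two radicals makes every entry rational in \<open>x\<close>,
    \<open>p\<close> and \<open>t\<close>, subject to the values of \<open>p^2\<close> and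
    \<open>t^2\<close>.\<close>
  define p t where "p = sqrt (1 - x\<^sup>2)" and "t = sqrt (4 * x\<^sup>2 - 3)"
  have x: "x\<^sup>2 < 1"
    using assms by (simp add: power_less_one_iff)
  have p: "p > 0" "p\<^sup>2 = 1 - x\<^sup>2" and t: "t\<^sup>2 = 4 * x\<^sup>2 - 3"
    using x assms by (simp_all add: p_def t_def)
  have quot: "sqrt ((4 * x\<^sup>2 - 3) / (1 - x\<^sup>2)) = t / p"
    by (simp add: p_def t_def real_sqrt_divide)
  have "(3 - 4 * x\<^sup>2) / (x\<^sup>2 - 1) = (4 * x\<^sup>2 - 3) / (1 - x\<^sup>2)"
    by (metis minus_diff_eq minus_divide_divide)
  then have quot': "sqrt ((3 - 4 * x\<^sup>2) / (x\<^sup>2 - 1)) = t / p"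
    by (simp only: quot)
  have cube: "sqrt ((4 * x\<^sup>2 - 3)^3) = t * t\<^sup>2"
    unfolding t_def real_sqrt_power by (simp only: power3_eq_cube power2_eq_square mult.assoc)
  have A: "rep_A x = Quat x p 0 0"
    using assms by (simp add: rep_A_def p_def)
  have B: "rep_B x = Quat x ((2 * x\<^sup>2 - 1) / (2 * p)) (t / (2 * p)) 0"
    using assms by (simp add: rep_B_def quot p_def[symmetric])
  let ?c = "(2 * x\<^sup>2 - 1) / (2 * p)" and ?d = "t / (2 * p)"
  \<comment> \<open>With \<open>q\<close> for \<open>1 - x^2\<close>, the denominators become
    multiples of a single positive variable.\<close>
  obtain q where x2: "x\<^sup>2 = 1 - q" and q: "q > 0"
    using that[of "1 - x\<^sup>2"] x by simp
  have x4: "x^4 = (x\<^sup>2)\<^sup>2"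
    by simp
  have d2: "?d\<^sup>2 = (4 * x\<^sup>2 - 3) / (4 * (1 - x\<^sup>2))"
    by (simp add: power_divide power_mult_distrib p t)
  have "?c\<^sup>2 = (2 * x\<^sup>2 - 1)\<^sup>2 / (4 * (1 - x\<^sup>2))"
    by (simp add: power_divide power_mult_distrib p)
  \<comment> \<open>This is the norm condition on \<open>rep_B x\<close>; it also eliminates
    \<open>?c\<close> from the diagonal matrix entries.\<close>
  then have c2: "?c\<^sup>2 = 1 - x\<^sup>2 + ?d\<^sup>2"
    unfolding d2 x2 using q by (simp add: field_simps power2_eq_square)
  show "braided_pair (rep_A x) (rep_B x) x"
    unfolding A B
  proof (rule braided_pair_planar)
    show "x\<^sup>2 + ?c\<^sup>2 - ?d\<^sup>2 = 1"
      unfolding c2 by simp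
  qed (use p in \<open>simp_all add: field_simps\<close>)
  have s: "s = - (t\<^sup>2 / (4 * x))"
    unfolding s_def t by (simp add: minus_divide_left)
  have mul: "y * z / (2 * (1 - x\<^sup>2)) = 2 * (z / (2 * p)) * (y / (2 * p))" for y z
    unfolding p(2)[symmetric] by (simp add: power2_eq_square ac_simps)
  \<comment> \<open>The factorization exhibits the last entry of the third row as
    \<open>s * ?c\<close>.\<close>
  have num: "- 3 + 10 * x\<^sup>2 - 8 * x^4 = (3 - 4 * x\<^sup>2) * (2 * x\<^sup>2 - 1)"
    by (simp add: power2_eq_square power4_eq_xxxx algebra_simps)
  {
    assume "has_form \<rho> s (rep_A x) (rep_B x)"
    note form = has_form_planar[OF this[unfolded A B]]
    show "is_affine_matrix (matrix_a x) (\<rho> trefoil_a)"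
      unfolding matrix_a_def if_P[OF \<open>x < 1\<close>] p_def[symmetric]
      by (rule is_affine_matrix_planarI[OF form(1)]) (simp_all add: p s_def)
    show "is_affine_matrix (matrix_b x) (\<rho> trefoil_b)"
      unfolding matrix_b_def if_P[OF \<open>x < 1\<close>] p_def[symmetric] t_def[symmetric] quot' cube
    proof (rule is_affine_matrix_planarI[OF form(2)], goal_cases)
      case 1 then show ?case unfolding c2 by simp
    next
      case 2 then show ?case using p by (simp add: field_simps power2_eq_square power3_eq_cube)
    next
      case 3 then show ?case using p by simp
    next
      case 4 then show ?case using p by simp
    next
      case 5 then show ?case using p by simp
    next
      case 6 then show ?case unfolding c2 unfolding d2 x4 x2 using q
        by (simp add: field_simps power2_eq_square)
    next
      case 7 then show ?case unfolding mul
        by (simp only: mult_minus_left mult_minus_right minus_minus mult.assoc mult.commute mult.left_commute)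
    next
      case 8 then show ?case by (simp add: s ac_simps)
    next
      case 9 then show ?case using p by simp
    next
      case 10 then show ?case unfolding mul
        by (simp only: mult_minus_left mult_minus_right minus_minus mult.assoc mult.commute mult.left_commute)
    next
      case 11 then show ?case unfolding c2 unfolding d2 x4 x2 using q
        by (simp add: field_simps power2_eq_square)
    next
      case 12 then show ?case unfolding num s_def by simp
    qed
  }
qed

text \<open>The elliptic computation with \<open>i\<close> and \<open>j\<close> exchanging roles:
  the pure part of \<open>rep_A x\<close> now lies along \<open>j\<close> and has norm
  \<open>1 - x^2 < 0\<close>.\<close>

lemma rep_hyperbolic:
  assumes "1 < x"
  defines "s \<equiv> (3 - 4 * x\<^sup>2) / (4 * x)"
  shows "braided_pair (rep_A x) (rep_B x) x"
    and "has_form \<rho> s (rep_A x) (rep_B x) \<Longrightarrow> is_affine_matrix (matrix_a x) (\<rho> trefoil_a)"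
    and "has_form \<rho> s (rep_A x) (rep_B x) \<Longrightarrow> is_affine_matrix (matrix_b x) (\<rho> trefoil_b)"
proof -
  define p t where "p = sqrt (x\<^sup>2 - 1)" and "t = sqrt (4 * x\<^sup>2 - 3)"
  have x: "x\<^sup>2 > 1"
    using assms by (simp add: one_less_power)
  have p: "p > 0" "p\<^sup>2 = x\<^sup>2 - 1" and t: "t\<^sup>2 = 4 * x\<^sup>2 - 3"
    using x by (simp_all add: p_def t_def)
  have quot: "sqrt ((4 * x\<^sup>2 - 3) / (x\<^sup>2 - 1)) = t / p"
    by (simp add: p_def t_def real_sqrt_divide)
  have cube: "sqrt ((4 * x\<^sup>2 - 3)^3) = t * t\<^sup>2"
    unfolding t_def real_sqrt_power by (simp only: power3_eq_cube power2_eq_square mult.assoc)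
  have nlt: "\<not> x < 1" "x \<noteq> 1"
    using assms by auto
  have A: "rep_A x = Quat x 0 p 0"
    using nlt by (simp add: rep_A_def p_def)
  let ?c = "- (t / (2 * p))" and ?d = "- ((2 * x\<^sup>2 - 1) / (2 * p))"
  have B: "rep_B x = Quat x ?c ?d 0"
    unfolding rep_B_def if_not_P[OF nlt(1)] if_not_P[OF nlt(2)] quot p_def[symmetric]
    by (simp only: minus_divide_left[symmetric] mult_minus_left) simp
  obtain q where x2: "x\<^sup>2 = 1 + q" and q: "q > 0"
    using that[of "x\<^sup>2 - 1"] x by simp
  have x4: "x^4 = (x\<^sup>2)\<^sup>2"
    by simp
  have c2: "?c\<^sup>2 = (4 * x\<^sup>2 - 3) / (4 * (x\<^sup>2 - 1))"
    by (simp add: power_divide power_mult_distrib p t)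
  have "?d\<^sup>2 = (2 * x\<^sup>2 - 1)\<^sup>2 / (4 * (x\<^sup>2 - 1))"
    by (simp add: power_divide power_mult_distrib p)
  then have d2: "?d\<^sup>2 = x\<^sup>2 - 1 + ?c\<^sup>2"
    unfolding c2 x2 using q by (simp add: field_simps power2_eq_square)
  show "braided_pair (rep_A x) (rep_B x) x"
    unfolding A B
  proof (rule braided_pair_planar)
    show "x\<^sup>2 + ?c\<^sup>2 - ?d\<^sup>2 = 1"
      unfolding d2 by simp
  qed (use p in \<open>simp_all add: field_simps\<close>)
  have s: "s = - (t\<^sup>2 / (4 * x))"
    unfolding s_def t by (simp add: minus_divide_left)
  have mul: "y * z / (2 * (x\<^sup>2 - 1)) = 2 * (z / (2 * p)) * (y / (2 * p))" for y z
    unfolding p(2)[symmetric] by (simp add: power2_eq_square ac_simps)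
  \<comment> \<open>Up to its denominator this is \<open>s * ?d\<close>, the last entry of the
    second row.\<close>
  have num: "3 - 10 * x\<^sup>2 + 8 * x^4 = - ((3 - 4 * x\<^sup>2) * (2 * x\<^sup>2 - 1))"
    by (simp add: power2_eq_square power4_eq_xxxx algebra_simps)
  {
    assume "has_form \<rho> s (rep_A x) (rep_B x)"
    note form = has_form_planar[OF this[unfolded A B]]
    show "is_affine_matrix (matrix_a x) (\<rho> trefoil_a)"
      unfolding matrix_a_def if_not_P[OF nlt(1)] if_not_P[OF nlt(2)] p_def[symmetric]
      by (rule is_affine_matrix_planarI[OF form(1)]) (simp_all add: p s_def)
    show "is_affine_matrix (matrix_b x) (\<rho> trefoil_b)"
      unfolding matrix_b_def if_not_P[OF nlt(1)] if_not_P[OF nlt(2)] p_def[symmetric]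
        t_def[symmetric] quot cube
    proof (rule is_affine_matrix_planarI[OF form(2)], goal_cases)
      case 1 then show ?case unfolding d2 by simp
    next
      case 2 then show ?case using p by simp
    next
      case 3 then show ?case using p by simp
    next
      case 4 then show ?case using p by simp
    next
      case 5 then show ?case using p by simp
    next
      case 6 then show ?case unfolding d2 unfolding c2 x4 x2 using q
        by (simp add: field_simps power2_eq_square)
    next
      case 7 then show ?case unfolding mul
        by (simp only: mult_minus_left mult_minus_right minus_minus mult.assoc mult.commute mult.left_commute)
    next
      case 8 then show ?case unfolding num s_def by simp
    next
      case 9 then show ?case using p by simp
    next
      case 10 then show ?case unfolding mul
        by (simp only: mult_minus_left mult_minus_right minus_minus mult.assoc mult.commute mult.left_commute)
    next
      case 11 then show ?case unfolding d2 unfolding c2 x4 x2 using q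
        by (simp add: field_simps power2_eq_square)
    next
      case 12 then show ?case by (simp add: s ac_simps)
    qed
  }
qed

text \<open>The pure part of \<open>rep_A 1\<close> is the nonzero null vector \<open>i + j\<close>,
  and \<open>- 1 / 4\<close> is the value of \<open>(3 - 4 * x^2) / (4 * x)\<close> at
  \<open>x = 1\<close>.\<close>

lemma rep_parabolic:
  shows "braided_pair (rep_A 1) (rep_B 1) 1"
    and "has_form \<rho> (- 1 / 4) (rep_A 1) (rep_B 1) \<Longrightarrow> is_affine_matrix (matrix_a 1) (\<rho> trefoil_a)"
    and "has_form \<rho> (- 1 / 4) (rep_A 1) (rep_B 1) \<Longrightarrow> is_affine_matrix (matrix_b 1) (\<rho> trefoil_b)"
proof -
  have A: "rep_A 1 = Quat 1 1 1 0" and B: "rep_B 1 = Quat 1 (1 / 4) (- (1 / 4)) 0"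
    by (simp_all add: rep_A_def rep_B_def)
  show "braided_pair (rep_A 1) (rep_B 1) 1"
    unfolding A B by (rule braided_pair_planar) simp_all
  {
    assume "has_form \<rho> (- 1 / 4) (rep_A 1) (rep_B 1)"
    note form = has_form_planar[OF this[unfolded A B]]
    have if_1: "(if (1 :: real) < 1 then M else if (1 :: real) = 1 then N else P) = N" for M N P :: "real^4^4"
      by simp
    show "is_affine_matrix (matrix_a 1) (\<rho> trefoil_a)"
      unfolding matrix_a_def if_1
      by (rule is_affine_matrix_planarI[OF form(1)]) simp_all
    show "is_affine_matrix (matrix_b 1) (\<rho> trefoil_b)"
      unfolding matrix_b_def if_1
      by (rule is_affine_matrix_planarI[OF form(2)]) (simp_all add: power2_eq_square)
  }
qed

theorem theorem14:
  fixes x :: real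
  assumes "x > sqrt 3 / 2"
  shows "rep_A x \<in> SL2 \<and> rep_B x \<in> SL2 \<and>
    (\<exists>\<rho> \<in> hom trefoil_group affine_isom_group. \<exists>s :: real.
       has_form \<rho> s (rep_A x) (rep_B x) \<and>
       (\<forall>\<rho>' \<in> hom trefoil_group affine_isom_group. \<forall>s' :: real. \<forall>C \<in> SL2.
          has_form \<rho>' s' (C * rep_A x * qconj C) (C * rep_B x * qconj C)
            \<longrightarrow> conjugate_reps \<rho> \<rho>') \<and>
       is_affine_matrix (matrix_a x) (\<rho> trefoil_a) \<and>
       is_affine_matrix (matrix_b x) (\<rho> trefoil_b) \<and>
       axis_distance (rep_A x) (rep_B x) = csqrt (complex_of_real (3 - 4 * x^2)) / 4 \<and>
       (x \<noteq> 1 \<longrightarrow>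
          cos (axis_angle (rep_A x) (rep_B x)) = complex_of_real ((2 * x^2 - 1) / (2 - 2 * x^2))) \<and>
       axis_shift s (rep_A x) =
         complex_of_real (3 / (4 * x) - x) * csqrt (complex_of_real (1 - x^2)))"
proof -
  let ?s = "(3 - 4 * x\<^sup>2) / (4 * x)"
  have "0 < sqrt 3 / 2"
    by simp
  with assms have pos: "x > 0"
    by linarith
  \<comment> \<open>Squaring the bound gives \<open>3 < 4 * x^2\<close>, which keeps
    \<open>D\<close> nonzero; positivity of \<open>x\<close> makes the equation for \<open>s\<close>
    solvable.\<close>
  have "(sqrt 3 / 2)\<^sup>2 < x\<^sup>2"
    using assms by (intro power_strict_mono) auto
  then have sq: "3 < 4 * x\<^sup>2"
    by (simp add: power_divide)
  \<comment> \<open>Trichotomy of \<open>x\<close> against 1 merges the three families under the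
    common parameter \<open>?s\<close>.\<close>
  have reps: "braided_pair (rep_A x) (rep_B x) x"
    "has_form \<rho> ?s (rep_A x) (rep_B x) \<Longrightarrow> is_affine_matrix (matrix_a x) (\<rho> trefoil_a)"
    "has_form \<rho> ?s (rep_A x) (rep_B x) \<Longrightarrow> is_affine_matrix (matrix_b x) (\<rho> trefoil_b)" for \<rho>
    using rep_elliptic[OF sq pos] rep_parabolic rep_hyperbolic[of x]
    by (cases x "1 :: real" rule: linorder_cases; force)+
  interpret braided_pair "rep_A x" "rep_B x" x
    by (rule reps(1))
  have nz: "x \<noteq> 0" "4 * x\<^sup>2 \<noteq> 3"
    using pos sq by auto
  obtain \<rho> where \<rho>: "\<rho> \<in> hom trefoil_group affine_isom_group" "has_form \<rho> ?s (rep_A x) (rep_B x)"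
    using trefoil_rep[OF nz] by blast
  have "?s = 3 / (4 * x) - x"
    using pos by (simp add: field_simps power2_eq_square)
  then have shift: "axis_shift ?s (rep_A x) = complex_of_real (3 / (4 * x) - x) * csqrt (complex_of_real (1 - x^2))"
    by (simp only: axis_shift_def qnorm_pure_part[OF SL2(1)] scal)
  show ?thesis
    using SL2 \<rho> reps(2,3)[OF \<rho>(2)] trefoil_rep_unique[OF nz(2,1) \<rho>] axis_distance_eq
      cos_axis_angle_eq shift
    by blast
qed

end
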